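(* Fix $1 < N \le M$. Let $Y$ be a system of $M$ competing Brownian particles with drift coefficients $(g_k)_{1 \le k \le M}$, diffusion coefficients $(\sigma_k^2)_{1 \le k \le M}$ and parameters of collision $(q^{\pm}_k)_{1 \le k \le M}$, starting from $y \in \mathcal{W}_M$, and let $B_1, \ldots, B_M$ be its driving Brownian motions. Let $\overline{Y}$ be the system of $N$ competing Brownian particles with parameters $(g_k)_{1 \le k \le N}$, $(\sigma_k^2)_{1 \le k \le N}$, $(q^{\pm}_k)_{1 \le k \le N}$, starting from $(y_1,\ldots,y_N)'$, with driving Brownian motions $B_1, \ldots, B_N$. Let $Z$, $\overline{Z}$ be the corresponding gap processes, and let $L$, $\overline{L}$ be the corresponding vectors of collision local times. Then $$Y_k(t) \le \overline{Y}_k(t), \quad k = 1, \ldots, N,\ t \ge 0;$$ $$Z_k(t) \le \overline{Z}_k(t), \quad k = 1, \ldots, N-1,\ t \ge 0;$$ $$L_{(k,k+1)}(t) - L_{(k,k+1)}(s) \ge \overline{L}_{(k,k+1)}(t) - \overline{L}_{(k,k+1)}(s), \quad k = 1, \ldots, N-1,\ 0 \le s \le t.$$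
   Context: $\mathcal{W}_N := \{y \in \mathbb{R}^N \mid y_1 \le \ldots \le y_N\}$. Parameters of collision for $N$ particles are real numbers $q^{\pm}_1, \ldots, q^{\pm}_N$ with $q^+_{k+1} + q^-_k = 1$ for $k = 1, \ldots, N-1$ and $0 < q^{\pm}_k < 1$ for $k = 1, \ldots, N$. (For the smaller system, which only involves indices up to $N$, the relation is required for $k\le N-1$.) System of $N$ competing Brownian particles: on a filtered probability space satisfying the usual conditions, take i.i.d. standard Brownian motions $B_1,\ldots,B_N$ (driving Brownian motions), real numbers $g_1,\ldots,g_N$ (drift coefficients), positive reals $\sigma_1,\ldots,\sigma_N$ (diffusion coefficients $\sigma_k^2$), and parameters of collision $(q^{\pm}_k)$. The system is a continuous adapted $\mathcal{W}_N$-valued process $Y = (Y_1,\ldots,Y_N)'$ together with continuous adapted processes $L_{(1,2)},\ldots,L_{(N-1,N)}$ (local times of collision) such that, with $L_{(0,1)} \equiv 0 \equiv L_{(N,N+1)}$, $$Y_k(t) = Y_k(0) + g_k t + \sigma_k B_k(t) + q^+_k L_{(k-1,k)}(t) - q^-_k L_{(k,k+1)}(t),\quad k=1,\ldots,N,\ t\ge 0,$$ where each $L_{(k,k+1)}$ is nondecreasing, starts from $0$, and can increase only when $Y_k = Y_{k+1}$. It exists in the strong sense and is pathwise unique. The vector of local times is $L = (L_{(1,2)},\ldots,L_{(N-1,N)})'$ and the gap process is $Z = (Z_1,\ldots,Z_{N-1})'$ with $Z_k(t) = Y_{k+1}(t) - Y_k(t)$. *)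

theory Defs
  imports "HOL-Probability.Probability"
begin

section \<open>Filtered probability spaces and Brownian motion\<close>

text \<open>
  Time is \<open>[0,\<infinity>)\<close>, represented by the nonnegative reals; values of filtrations and processes at
  negative times are irrelevant. A real-valued process is a function \<open>X\<close> taking a time and
  an outcome. Path properties are required almost surely, simultaneously for all times.
\<close>

locale usual_filtered_prob_space =
  prob_space P + complete_measure P + filtration "space P" "\<lambda>t. F (max 0 t)"
  for P :: "'a measure" and F :: "real \<Rightarrow> 'a measure" +
  assumes F_subalgebra: "\<And>t. 0 \<le> t \<Longrightarrow> subalgebra P (F t)"
    and F_null_sets: "null_sets P \<subseteq> sets (F 0)"
    and F_right_continuous: "\<And>t. 0 \<le> t \<Longrightarrow> sets (F t) = (\<Inter>u\<in>{t<..}. sets (F u))"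

definition adapted_process :: "(real \<Rightarrow> 'a measure) \<Rightarrow> (real \<Rightarrow> 'a \<Rightarrow> real) \<Rightarrow> bool" where
  "adapted_process F X \<longleftrightarrow> (\<forall>t\<ge>0. X t \<in> borel_measurable (F t))"

definition continuous_process :: "'a measure \<Rightarrow> (real \<Rightarrow> 'a \<Rightarrow> real) \<Rightarrow> bool" where
  "continuous_process P X \<longleftrightarrow> (AE \<omega> in P. continuous_on {0..} (\<lambda>t. X t \<omega>))"

definition standard_brownian_motion ::
    "'a measure \<Rightarrow> (real \<Rightarrow> 'a measure) \<Rightarrow> (real \<Rightarrow> 'a \<Rightarrow> real) \<Rightarrow> bool" where
  "standard_brownian_motion P F W \<longleftrightarrow>
     adapted_process F W \<and> continuous_process P W \<and> (AE \<omega> in P. W 0 \<omega> = 0) \<and>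
     (\<forall>s t. 0 \<le> s \<and> s < t \<longrightarrow>
        distributed P lborel (\<lambda>\<omega>. W t \<omega> - W s \<omega>) (normal_density 0 (sqrt (t - s))) \<and>
        prob_space.indep_set P (sets (F s))
          (sets (vimage_algebra (space P) (\<lambda>\<omega>. W t \<omega> - W s \<omega>) borel)))"

text \<open>
  Independence is that of the processes as random elements of the product space
  \<open>\<real>\<^bsup>[0,\<infinity>)\<^esup>\<close>; being identically distributed is part of being standard Brownian motions.
\<close>

definition iid_brownian_motions ::
    "'a measure \<Rightarrow> (real \<Rightarrow> 'a measure) \<Rightarrow> nat \<Rightarrow> (nat \<Rightarrow> real \<Rightarrow> 'a \<Rightarrow> real) \<Rightarrow> bool" where
  "iid_brownian_motions P F N B \<longleftrightarrow>
     (\<forall>k\<in>{1..N}. standard_brownian_motion P F (B k)) \<and>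
     prob_space.indep_vars P (\<lambda>_. Pi\<^sub>M {0..} (\<lambda>_. borel))
       (\<lambda>k \<omega>. restrict (\<lambda>t. B k t \<omega>) {0..}) {1..N}"

section \<open>Competing Brownian particles\<close>

text \<open>Vectors are functions on \<open>nat\<close> of which only the components \<open>1, \<dots>, N\<close> matter.\<close>

definition ordered_vectors :: "nat \<Rightarrow> (nat \<Rightarrow> real) set" where
  "ordered_vectors N = {y. mono_on {1..N} y}"

definition collision_parameters :: "nat \<Rightarrow> (nat \<Rightarrow> real) \<Rightarrow> (nat \<Rightarrow> real) \<Rightarrow> bool" where
  "collision_parameters N qp qm \<longleftrightarrow>
     (\<forall>k\<in>{1..N}. 0 < qp k \<and> qp k < 1 \<and> 0 < qm k \<and> qm k < 1) \<and>
     (\<forall>k\<in>{1..<N}. qp (k + 1) + qm k = 1)"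

text \<open>
  For a continuous nondecreasing path \<open>l\<close> on \<open>[0,\<infinity>)\<close>: the Stieltjes measure \<open>dl\<close> does not charge
  the times outside \<open>A\<close>. The library's Stieltjes measures live on the whole real line, so \<open>l\<close> is
  extended to negative times by \<open>l 0\<close>.
\<close>

definition increases_only_on :: "(real \<Rightarrow> real) \<Rightarrow> real set \<Rightarrow> bool" where
  "increases_only_on l A \<longleftrightarrow>
     (AE s in interval_measure (\<lambda>s. l (max 0 s)). 0 \<le> s \<longrightarrow> s \<in> A)"

text \<open>
  \<open>L k\<close> is the local time \<open>L\<^bsub>(k,k+1)\<^esub>\<close> of collision between the particles \<open>k\<close> and \<open>k + 1\<close>; in
  particular \<open>L 0\<close> and \<open>L N\<close> are the conventional zero processes. \<open>\<sigma> k\<close> is the square root of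
  the diffusion coefficient.
\<close>

definition competing_brownian_particles ::
    "'a measure \<Rightarrow> (real \<Rightarrow> 'a measure) \<Rightarrow> nat \<Rightarrow> (nat \<Rightarrow> real) \<Rightarrow> (nat \<Rightarrow> real) \<Rightarrow>
     (nat \<Rightarrow> real) \<Rightarrow> (nat \<Rightarrow> real) \<Rightarrow> (nat \<Rightarrow> real \<Rightarrow> 'a \<Rightarrow> real) \<Rightarrow>
     (nat \<Rightarrow> real \<Rightarrow> 'a \<Rightarrow> real) \<Rightarrow> (nat \<Rightarrow> real \<Rightarrow> 'a \<Rightarrow> real) \<Rightarrow> bool" where
  "competing_brownian_particles P F N g \<sigma> qp qm B Y L \<longleftrightarrow>
     (\<forall>k\<in>{1..N}. 0 < \<sigma> k) \<and>
     collision_parameters N qp qm \<and>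
     iid_brownian_motions P F N B \<and>
     (\<forall>k\<in>{1..N}. adapted_process F (Y k) \<and> continuous_process P (Y k)) \<and>
     (\<forall>k\<in>{1..<N}. adapted_process F (L k) \<and> continuous_process P (L k)) \<and>
     (AE \<omega> in P.
        (\<forall>t\<ge>0. (\<lambda>k. Y k t \<omega>) \<in> ordered_vectors N) \<and>
        (\<forall>t\<ge>0. L 0 t \<omega> = 0 \<and> L N t \<omega> = 0) \<and>
        (\<forall>k\<in>{1..N}. \<forall>t\<ge>0.
           Y k t \<omega> = Y k 0 \<omega> + g k * t + \<sigma> k * B k t \<omega>
                     + qp k * L (k - 1) t \<omega> - qm k * L k t \<omega>) \<and>
        (\<forall>k\<in>{1..<N}.
           L k 0 \<omega> = 0 \<and> mono_on {0..} (\<lambda>t. L k t \<omega>) \<and>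
           increases_only_on (\<lambda>t. L k t \<omega>) {t. Y k t \<omega> = Y (k + 1) t \<omega>}))"

definition starts_from ::
    "'a measure \<Rightarrow> nat \<Rightarrow> (nat \<Rightarrow> real \<Rightarrow> 'a \<Rightarrow> real) \<Rightarrow> (nat \<Rightarrow> real) \<Rightarrow> bool" where
  "starts_from P N Y y \<longleftrightarrow> (AE \<omega> in P. \<forall>k\<in>{1..N}. Y k 0 \<omega> = y k)"

definition gap_process ::
    "(nat \<Rightarrow> real \<Rightarrow> 'a \<Rightarrow> real) \<Rightarrow> nat \<Rightarrow> real \<Rightarrow> 'a \<Rightarrow> real" where
  "gap_process Y k t \<omega> = Y (k + 1) t \<omega> - Y k t \<omega>"

end

theory Submission
  imports Defs
begin

text \<open>
  The argument is pathwise. Put \<open>D\<^sub>k = L\<^sub>k - L'\<^sub>k\<close> and \<open>E\<^sub>k = Z'\<^sub>k - Z\<^sub>k\<close>, so that \<open>D\<close> and \<open>E\<close> vanish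
  at time 0 and \<open>E\<^sub>k = - D\<^sub>k + q\<^sup>-\<^sub>k\<^sub>+\<^sub>1 D\<^sub>k\<^sub>+\<^sub>1 + q\<^sup>+\<^sub>k D\<^sub>k\<^sub>-\<^sub>1\<close>; here \<open>D\<^sub>0 = 0\<close>, while \<open>D\<^sub>N = L\<^sub>N\<close> is nondecreasing.
  Since local times grow only at collisions, \<open>D\<^sub>k\<close> is nonincreasing while \<open>E\<^sub>k < 0\<close> and nondecreasing
  while \<open>E\<^sub>k > 0\<close>. Call nondecreasing \<open>b\<^sub>k\<close> with \<open>b\<^sub>k(0) = 0\<close> a bound if all \<open>D\<^sub>k + b\<^sub>k\<close> are nondecreasing.
  If \<open>b\<close> is a bound, then so is \<open>q\<^sup>-\<^sub>k\<^sub>+\<^sub>1 b\<^sub>k\<^sub>+\<^sub>1 + q\<^sup>+\<^sub>k b\<^sub>k\<^sub>-\<^sub>1 - E\<^sub>k\<^sup>-\<close>. As \<open>L'\<close> is a bound and the matrix of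
  this recursion contracts a weighted supremum norm, there are arbitrarily small bounds, so \<open>D\<close>
  is nondecreasing. Then \<open>0\<close> is a bound as well, so \<open>- E\<^sub>k\<^sup>-\<close> is nondecreasing from 0, that is \<open>E\<^sub>k \<ge> 0\<close>.
\<close>

section \<open>Real paths: constancy away from the growth set, and last zeros\<close>

text \<open>The interval from \<open>a\<close> to \<open>b\<close> is a null set of the Stieltjes
  measure, whose mass there is \<open>l b - l a\<close>. Leaving out the left endpoint allows
  \<open>a\<close> itself to be a collision time, as happens when \<open>a\<close> is a last zero of
  the difference of gaps.\<close>

lemma increases_only_on_constant:
  fixes l :: "real \<Rightarrow> real"
  assumes inc: "increases_only_on l A"
    and cont: "continuous_on {0..} l" and mono: "mono_on {0..} l"
    and "0 \<le> a" "a \<le> b" and disj: "{a<..b} \<inter> A = {}"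
  shows "l b = l a"
proof -
  let ?F = "\<lambda>s. l (max 0 s)"
  have "continuous_on UNIV ?F"
    by (rule continuous_on_compose2[OF cont]) (auto intro!: continuous_intros)
  then have rc: "continuous (at_right x) ?F" for x
    by (simp add: continuous_on_eq_continuous_within continuous_at_imp_continuous_within)
  have m: "?F x \<le> ?F y" if "x \<le> y" for x y
    using that by (intro mono_onD[OF mono]) auto
  have "AE s in interval_measure ?F. s \<notin> {a<..b}"
    using inc[unfolded increases_only_on_def] by eventually_elim (use disj \<open>0 \<le> a\<close> in auto)
  then have "emeasure (interval_measure ?F) {a<..b} = 0"
    by (subst (asm) AE_iff_measurable[where N = "{a<..b}"]) auto
  moreover have "emeasure (interval_measure ?F) {a<..b} = ennreal (?F b - ?F a)"
    by (rule emeasure_interval_measure_Ioc[OF \<open>a \<le> b\<close> m rc])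
  ultimately have "l b \<le> l a"
    using \<open>0 \<le> a\<close> \<open>a \<le> b\<close> by (simp add: max_absorb2 ennreal_eq_0_iff)
  with m[OF \<open>a \<le> b\<close>] show ?thesis
    using \<open>0 \<le> a\<close> \<open>a \<le> b\<close> by (simp add: max_absorb2)
qed

text \<open>The zero set in the interval is compact, so it has a largest element; a nonnegative
  value after it would force a further zero by the intermediate value theorem.\<close>

lemma last_zero:
  fixes f :: "real \<Rightarrow> real"
  assumes cont: "continuous_on {s..t} f" and "s \<le> t" and "0 \<le> f s" and "f t < 0"
  obtains u where "s \<le> u" "u \<le> t" "f u = 0" "\<And>v. u < v \<Longrightarrow> v \<le> t \<Longrightarrow> f v < 0"
proof -
  let ?S = "{x \<in> {s..t}. f x = 0}"
  have "?S \<noteq> {}"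
    using IVT2'[of f t 0 s] assms by auto
  moreover have "closed ?S"
    using continuous_closed_preimage_constant[OF cont] by simp
  then have "compact ?S"
    by (metis (no_types, lifting) bounded_closed_interval bounded_subset compact_eq_bounded_closed mem_Collect_eq subsetI)
  ultimately obtain u where u: "u \<in> ?S" and umax: "\<And>x. x \<in> ?S \<Longrightarrow> x \<le> u"
    using compact_attains_sup[of ?S] by blast
  show thesis
  proof (rule that[of u])
    fix v assume v: "u < v" "v \<le> t"
    show "f v < 0"
    proof (rule ccontr)
      assume "\<not> f v < 0"
      moreover have "continuous_on {v..t} f"
        using cont by (rule continuous_on_subset) (use u v in auto)
      ultimately obtain x where "v \<le> x" "x \<le> t" "f x = 0"
        using IVT2'[of f t 0 v] \<open>f t < 0\<close> v by auto
      with umax[of x] u v show False by auto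
    qed
  qed (use u in auto)
qed

section \<open>One comparison step for a single pair of neighbours\<close>

text \<open>The term \<open>- max 0 (- E t)\<close> is the minimum of 0 and \<open>E t\<close>.
  Where \<open>E\<close> is negative, the first function is \<open>a + E\<close>, that is
  \<open>D + E + a\<close> minus the nonincreasing \<open>D\<close>, and the second is
  \<open>D + E + a\<close>. Where \<open>E\<close> is positive, they are \<open>a\<close> and
  \<open>D + a\<close>. These pieces are nondecreasing, and they are joined at a last zero of
  \<open>E\<close>, where both descriptions agree.\<close>

lemma comparison_step:
  fixes D E a :: "real \<Rightarrow> real"
  assumes cont: "continuous_on {0..} E"
    and decr: "\<And>u t. 0 \<le> u \<Longrightarrow> u \<le> t \<Longrightarrow> (\<And>v. u < v \<Longrightarrow> v \<le> t \<Longrightarrow> E v < 0) \<Longrightarrow> D t \<le> D u"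
    and incr: "\<And>u t. 0 \<le> u \<Longrightarrow> u \<le> t \<Longrightarrow> (\<And>v. u < v \<Longrightarrow> v \<le> t \<Longrightarrow> 0 < E v) \<Longrightarrow> D u \<le> D t"
    and a: "mono_on {0..} a"
    and DEa: "mono_on {0..} (\<lambda>t. D t + E t + a t)"
  shows "mono_on {0..} (\<lambda>t. a t - max 0 (- E t))"
    and "mono_on {0..} (\<lambda>t. D t + (a t - max 0 (- E t)))"
proof -
  have cont': "continuous_on {s..t} E" "continuous_on {s..t} (\<lambda>x. - E x)" if "0 \<le> s" for s t
    using that by (auto intro!: continuous_intros continuous_on_subset[OF cont])
  have a': "a s \<le> a t" and DEa': "D s + E s + a s \<le> D t + E t + a t" if "0 \<le> s" "s \<le> t" for s t
    using mono_onD[OF a, of s t] mono_onD[OF DEa, of s t] that by auto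
  show "mono_on {0..} (\<lambda>t. a t - max 0 (- E t))"
  proof (rule mono_onI)
    fix s t :: real assume "s \<in> {0..}" "s \<le> t"
    then have st: "0 \<le> s" "s \<le> t" by auto
    show "a s - max 0 (- E s) \<le> a t - max 0 (- E t)"
    proof (cases "0 \<le> E t")
      case True
      then show ?thesis using a'[OF st] by auto
    next
      case Et: False
      show ?thesis
      proof (cases "\<forall>v. s < v \<and> v \<le> t \<longrightarrow> E v < 0")
        case True
        then have "D t \<le> D s" using st by (intro decr) auto
        with DEa'[OF st] Et show ?thesis by auto
      next
        case False
        then obtain w where w: "s < w" "w \<le> t" "0 \<le> E w" by (auto simp: not_less)
        \<comment> \<open>From \<open>s\<close> to \<open>u\<close> only the growth of
          \<open>a\<close> is used, and from \<open>u\<close> to \<open>t\<close> the sign of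
          \<open>E\<close> is constant.\<close>
        obtain u where u: "w \<le> u" "u \<le> t" "E u = 0" "\<And>v. u < v \<Longrightarrow> v \<le> t \<Longrightarrow> E v < 0"
          using last_zero[OF cont'(1)[of w t]] w st Et by (auto simp: not_le)
        have "D t \<le> D u" using u w st by (intro decr) auto
        moreover have "D u + E u + a u \<le> D t + E t + a t" "a s \<le> a u"
          using u w st by (intro DEa' a'; simp)+
        ultimately show ?thesis using u(3) Et by auto
      qed
    qed
  qed
  show "mono_on {0..} (\<lambda>t. D t + (a t - max 0 (- E t)))"
  proof (rule mono_onI)
    fix s t :: real assume "s \<in> {0..}" "s \<le> t"
    then have st: "0 \<le> s" "s \<le> t" by auto
    show "D s + (a s - max 0 (- E s)) \<le> D t + (a t - max 0 (- E t))"
    proof (cases "E t \<le> 0")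
      case True
      with DEa'[OF st] show ?thesis by auto
    next
      case Et: False
      show ?thesis
      proof (cases "\<forall>v. s < v \<and> v \<le> t \<longrightarrow> 0 < E v")
        case True
        then have "D s \<le> D t" using st by (intro incr) auto
        with a'[OF st] Et show ?thesis by auto
      next
        case False
        then obtain w where w: "s < w" "w \<le> t" "E w \<le> 0" by (auto simp: not_less)
        \<comment> \<open>Here the two pieces swap roles: up to \<open>u\<close> the growth of
          \<open>D + E + a\<close> is used, afterwards that of \<open>D\<close> and
          \<open>a\<close>.\<close>
        obtain u where u: "w \<le> u" "u \<le> t" "E u = 0" "\<And>v. u < v \<Longrightarrow> v \<le> t \<Longrightarrow> 0 < E v"
          using last_zero[OF cont'(2)[of w t]] w st Et by (auto simp: not_le)
        have "D u \<le> D t" using u w st by (intro incr) auto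
        moreover have "D s + E s + a s \<le> D u + E u + a u" "a u \<le> a t"
          using u w st by (intro DEa' a'; simp)+
        ultimately show ?thesis using u(3) Et by auto
      qed
    qed
  qed
qed

section \<open>Weights for which the collision matrix is a contraction\<close>

text \<open>
  The transpose of the matrix is the transition matrix of a killed nearest-neighbour random walk.
  The weights are a strictly superharmonic function \<open>c\<close> for it times its reversible measure \<open>m\<close>.
\<close>

lemma collision_parameters_contraction:
  assumes "collision_parameters N qp qm"
  obtains v :: "nat \<Rightarrow> real" and \<rho> where "0 \<le> \<rho>" "\<rho> < 1" "v 0 = 0" "\<And>k. k \<in> {1..N} \<Longrightarrow> 0 < v k"
    "\<And>k. k \<in> {1..<N} \<Longrightarrow> qm (k + 1) * v (k + 1) + qp k * v (k - 1) \<le> \<rho> * v k"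
proof -
  have q: "0 < qp k" "qp k < 1" "0 < qm k" "qm k < 1" if "k \<in> {1..N}" for k
    using assms that by (auto simp: collision_parameters_def)
  have q1: "qp (k + 1) + qm k = 1" if "k \<in> {1..<N}" for k
    using assms that by (auto simp: collision_parameters_def)
  \<comment> \<open>Since \<open>r\<close> is at most \<open>qm k\<close> and
    \<open>qp (k + 1) < 1\<close>, it satisfies \<open>qp (k + 1) * r < qm k\<close>. The increments
    \<open>r ^ k\<close> of \<open>c\<close> then shrink fast enough for strict
    superharmonicity.\<close>
  define r where "r = Min (insert 1 (qm ` {1..N}))"
  have r0: "0 < r" using q by (auto simp: r_def)
  have rle: "r \<le> qm k" if "k \<in> {1..N}" for k
    unfolding r_def using that by (intro Min_le) auto
  define c where "c = (\<lambda>k::nat. \<Sum>i<k. r ^ i)"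
  define m where "m = (\<lambda>k::nat. \<Prod>i=1..k. qp i / qm i)"
  define v where "v = (\<lambda>k. m k * c k)"
  have mpos: "0 < m k" if "k \<le> N" for k
    unfolding m_def by (rule prod_pos) (use that q in auto)
  have cpos: "0 < c k" if "0 < k" for k
    unfolding c_def by (rule sum_pos) (use that r0 in auto)
  \<comment> \<open>Detailed balance for the walk that steps from \<open>k\<close> up with
    probability \<open>qp (k + 1)\<close> and down with probability \<open>qm k\<close>.\<close>
  have balance: "m (k + 1) * qm (k + 1) = m k * qp (k + 1)" if "k + 1 \<in> {1..N}" for k
    using q[OF that] by (simp add: m_def)
  have less: "qm (k + 1) * v (k + 1) + qp k * v (k - 1) < v k" if k: "k \<in> {1..<N}" for k
  proof -
    from k obtain j where j: "k = Suc j" by (cases k) auto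
    have "qp (k + 1) * r ^ k = (qp (k + 1) * r) * r ^ j" by (simp add: j)
    also have "\<dots> < qm k * r ^ j"
    proof (rule mult_strict_right_mono)
      have "qp (k + 1) * r < 1 * r"
        using q[of "k + 1"] k r0 by (intro mult_strict_right_mono) auto
      also have "\<dots> \<le> qm k" using rle[of k] k by auto
      finally show "qp (k + 1) * r < qm k" .
    qed (use r0 in auto)
    finally have lt: "qp (k + 1) * r ^ k < qm k * r ^ j" .
    have "qp (k + 1) * c (k + 1) + qm k * c j = (qp (k + 1) + qm k) * c k + (qp (k + 1) * r ^ k - qm k * r ^ j)"
      by (simp add: c_def j algebra_simps)
    with lt q1[OF k] have super: "qp (k + 1) * c (k + 1) + qm k * c j < c k" by simp
    have "qm (k + 1) * v (k + 1) + qp k * v (k - 1)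
        = (m (k + 1) * qm (k + 1)) * c (k + 1) + (m j * qp (j + 1)) * c j"
      by (simp add: v_def j)
    also have "\<dots> = m k * (qp (k + 1) * c (k + 1) + qm k * c j)"
      using balance[of k] balance[of j] k by (simp add: j algebra_simps)
    also have "\<dots> < m k * c k"
      using super mpos[of k] k by (intro mult_strict_left_mono) auto
    finally show ?thesis by (simp add: v_def)
  qed
  have vpos: "0 < v k" if "k \<in> {1..N}" for k using that mpos[of k] cpos[of k] by (simp add: v_def)
  define f where "f = (\<lambda>k. (qm (k + 1) * v (k + 1) + qp k * v (k - 1)) / v k)"
  \<comment> \<open>Finitely many strict inequalities leave a uniform gap below 1. Inserting 0
    covers an empty index set and keeps \<rho> nonnegative.\<close>
  define \<rho> where "\<rho> = Max (insert 0 (f ` {1..<N}))"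
  show thesis
  proof (rule that[of \<rho> v])
    show "0 \<le> \<rho>" by (simp add: \<rho>_def)
    have "f k < 1" if "k \<in> {1..<N}" for k
      using less[OF that] vpos[of k] that by (simp add: f_def)
    then show "\<rho> < 1" by (simp add: \<rho>_def)
    show "v 0 = 0" by (simp add: v_def c_def)
    show "0 < v k" if "k \<in> {1..N}" for k using vpos that .
    show "qm (k + 1) * v (k + 1) + qp k * v (k - 1) \<le> \<rho> * v k" if "k \<in> {1..<N}" for k
    proof -
      have "f k \<le> \<rho>" unfolding \<rho>_def using that by (intro Max_ge) auto
      then show ?thesis using vpos[of k] that by (simp add: f_def pos_divide_le_eq)
    qed
  qed
qed

section \<open>Comparison for the coupled system of differences\<close>

text \<open>The component \<open>D N\<close> is only required to be nondecreasing, not zero: it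
  carries the whole influence of the particles above \<open>N\<close>. The functions
  \<open>L\<close> serve as the initial bound of the iteration.\<close>

lemma comparison_system:
  fixes D E L :: "nat \<Rightarrow> real \<Rightarrow> real"
  assumes q: "collision_parameters N qp qm"
    and E: "\<And>k t. k \<in> {1..<N} \<Longrightarrow> 0 \<le> t \<Longrightarrow>
      E k t = - D k t + qm (k + 1) * D (k + 1) t + qp k * D (k - 1) t"
    and cont: "\<And>k. k \<in> {1..<N} \<Longrightarrow> continuous_on {0..} (E k)"
    and decr: "\<And>k u t. k \<in> {1..<N} \<Longrightarrow> 0 \<le> u \<Longrightarrow> u \<le> t \<Longrightarrow>
      (\<And>v. u < v \<Longrightarrow> v \<le> t \<Longrightarrow> E k v < 0) \<Longrightarrow> D k t \<le> D k u"
    and incr: "\<And>k u t. k \<in> {1..<N} \<Longrightarrow> 0 \<le> u \<Longrightarrow> u \<le> t \<Longrightarrow>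
      (\<And>v. u < v \<Longrightarrow> v \<le> t \<Longrightarrow> 0 < E k v) \<Longrightarrow> D k u \<le> D k t"
    and init: "\<And>k. k \<in> {0..N} \<Longrightarrow> D k 0 = 0"
    and boundary: "mono_on {0..} (D 0)" "mono_on {0..} (D N)"
    and L: "\<And>k. k \<in> {1..<N} \<Longrightarrow> mono_on {0..} (L k)"
      "\<And>k. k \<in> {1..<N} \<Longrightarrow> L k 0 = 0"
      "\<And>k. k \<in> {1..<N} \<Longrightarrow> mono_on {0..} (\<lambda>t. D k t + L k t)"
    and k: "k \<in> {1..<N}"
  shows "mono_on {0..} (D k) \<and> (\<forall>t\<ge>0. 0 \<le> E k t)"
proof -
  \<comment> \<open>The end components can be 0 because \<open>D 0\<close> and \<open>D N\<close>
    are nondecreasing by themselves.\<close>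
  define bound where "bound b \<longleftrightarrow> (\<forall>t. b 0 t = 0 \<and> b N t = 0) \<and>
    (\<forall>k\<in>{0..N}. mono_on {0..} (b k) \<and> b k 0 = 0 \<and> mono_on {0..} (\<lambda>t. D k t + b k t))"
    for b :: "nat \<Rightarrow> real \<Rightarrow> real"
  define Q where "Q b = (\<lambda>k t. qm (k + 1) * b (k + 1) t + qp k * b (k - 1) t)"
    for b :: "nat \<Rightarrow> real \<Rightarrow> real"
  define next_b where "next_b b = (\<lambda>k t. if k \<in> {1..<N} then Q b k t - max 0 (- E k t) else 0)"
    for b :: "nat \<Rightarrow> real \<Rightarrow> real"
  have qpos: "0 < qp k" "0 < qm k" if "k \<in> {1..N}" for k
    using q that by (auto simp: collision_parameters_def)
  have E0: "E k 0 = 0" if "k \<in> {1..<N}" for k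
    using E[OF that, of 0] init that by auto
  have next_bound: "bound (next_b b)" if b: "bound b" for b
    unfolding bound_def
  proof (intro conjI ballI allI)
    fix i assume i: "i \<in> {0..N}"
    have *: "mono_on {0..} (next_b b i) \<and> next_b b i 0 = 0 \<and> mono_on {0..} (\<lambda>t. D i t + next_b b i t)"
    proof (cases "i \<in> {1..<N}")
      case True
      have bm: "b j s \<le> b j t" "D j s + b j s \<le> D j t + b j t" if "j \<in> {0..N}" "0 \<le> s" "s \<le> t" for j s t
        using b that mono_onD[of "{0..}" "b j" s t] mono_onD[of "{0..}" "\<lambda>t. D j t + b j t" s t]
        by (auto simp: bound_def)
      have p: "0 < qp i" "0 < qm (i + 1)" using qpos True by auto
      have a: "mono_on {0..} (Q b i)"
        unfolding Q_def using p True
        by (intro mono_onI add_mono mult_left_mono bm) auto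
      \<comment> \<open>By the linear relation for \<open>E\<close>, the term \<open>D i\<close>
        cancels and the sum is \<open>Q\<close> applied to \<open>D + b\<close>, a combination of
        nondecreasing functions with positive coefficients.\<close>
      have "mono_on {0..} (\<lambda>t. D i t + E i t + Q b i t)"
      proof (rule mono_onI)
        fix s t :: real assume st: "s \<in> {0..}" "t \<in> {0..}" "s \<le> t"
        have "qm (i + 1) * (D (i + 1) s + b (i + 1) s) + qp i * (D (i - 1) s + b (i - 1) s)
          \<le> qm (i + 1) * (D (i + 1) t + b (i + 1) t) + qp i * (D (i - 1) t + b (i - 1) t)"
          using p True st by (intro add_mono mult_left_mono bm(2)) auto
        then show "D i s + E i s + Q b i s \<le> D i t + E i t + Q b i t"
          using st by (simp add: E[OF True] Q_def algebra_simps)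
      qed
      note step = comparison_step[of "E i" "D i" "Q b i", OF cont[OF True] decr[OF True] incr[OF True] a this]
      have "next_b b i 0 = 0"
        using b E0[OF True] True by (auto simp: next_b_def Q_def bound_def)
      with step True show ?thesis by (simp add: next_b_def)
    next
      case False
      with i have "i = 0 \<or> i = N" by auto
      with False boundary show ?thesis by (auto simp: next_b_def intro: mono_onI)
    qed
    from * show "mono_on {0..} (next_b b i)" "next_b b i 0 = 0"
      "mono_on {0..} (\<lambda>t. D i t + next_b b i t)" by auto
  qed (auto simp: next_b_def)
  obtain v \<rho> where \<rho>: "0 \<le> \<rho>" "\<rho> < 1" and v0: "v 0 = 0" and vpos: "\<And>k. k \<in> {1..N} \<Longrightarrow> 0 < v k"
    and contr: "\<And>k. k \<in> {1..<N} \<Longrightarrow> qm (k + 1) * v (k + 1) + qp k * v (k - 1) \<le> \<rho> * v k"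
    using collision_parameters_contraction[OF q] by metis
  \<comment> \<open>The time \<open>T\<close> is fixed and only values at \<open>T\<close> are
    estimated. The sum \<open>C\<close> dominates each of its nonnegative terms, so
    \<open>L k T\<close> is at most \<open>C * v k\<close>.\<close>
  have small: "\<exists>b. bound b \<and> (\<forall>k\<in>{0..N}. b k T \<le> \<rho> ^ n * C * v k)"
    if T: "0 \<le> T" and C: "C = (\<Sum>k\<in>{1..<N}. L k T / v k)" for T C n
  proof -
    have pos: "0 \<le> L k T / v k" if "k \<in> {1..<N}" for k
      using mono_onD[OF L(1)[OF that], of 0 T] L(2)[OF that] T vpos[of k] that by auto
    have "0 \<le> C" unfolding C using pos by (intro sum_nonneg) auto
    show ?thesis
    proof (induction n)
      case 0
      define b where "b = (\<lambda>k t. if k \<in> {1..<N} then L k t else 0)"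
      have "mono_on {0..} (b i) \<and> b i 0 = 0 \<and> mono_on {0..} (\<lambda>t. D i t + b i t)" if "i \<in> {0..N}" for i
      proof (cases "i \<in> {1..<N}")
        case True
        then show ?thesis using L by (simp add: b_def)
      next
        case False
        with that have "i = 0 \<or> i = N" by auto
        with False boundary show ?thesis by (auto simp: b_def intro: mono_onI)
      qed
      then have "bound b" by (auto simp: bound_def b_def)
      have "b k T \<le> C * v k" if k: "k \<in> {0..N}" for k
      proof (cases "k \<in> {1..<N}")
        case True
        have "L k T / v k \<le> C"
          unfolding C using pos True by (intro member_le_sum) auto
        then show ?thesis using True vpos[of k] by (simp add: b_def pos_divide_le_eq)
      next
        case False
        have "0 \<le> v k" using k vpos[of k] v0 by (cases "k = 0") auto
        then show ?thesis using False \<open>0 \<le> C\<close> by (auto simp: b_def)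
      qed
      with \<open>bound b\<close> show ?case by auto
    next
      case (Suc n)
      then obtain b where b: "bound b" "\<And>k. k \<in> {0..N} \<Longrightarrow> b k T \<le> \<rho> ^ n * C * v k" by auto
      have C0: "0 \<le> \<rho> ^ n * C" using \<open>0 \<le> C\<close> \<rho> by simp
      have "next_b b k T \<le> \<rho> ^ Suc n * C * v k" if k: "k \<in> {0..N}" for k
      proof (cases "k \<in> {1..<N}")
        case True
        \<comment> \<open>Subtracting the negative part of \<open>E k\<close> only lowers the bound,
          so the contraction estimate for \<open>Q\<close> suffices.\<close>
        have "next_b b k T \<le> qm (k + 1) * b (k + 1) T + qp k * b (k - 1) T"
          using True by (simp add: next_b_def Q_def)
        also have "\<dots> \<le> qm (k + 1) * (\<rho> ^ n * C * v (k + 1)) + qp k * (\<rho> ^ n * C * v (k - 1))"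
          using True qpos[of k] qpos[of "k + 1"] by (intro add_mono mult_left_mono b) auto
        also have "\<dots> = \<rho> ^ n * C * (qm (k + 1) * v (k + 1) + qp k * v (k - 1))"
          by (simp add: algebra_simps)
        also have "\<dots> \<le> \<rho> ^ n * C * (\<rho> * v k)"
          using contr[OF True] C0 by (rule mult_left_mono)
        finally show ?thesis by (simp add: algebra_simps)
      next
        case False
        have "0 \<le> v k" using k vpos[of k] v0 by (cases "k = 0") auto
        then have "0 \<le> \<rho> * ((\<rho> ^ n * C) * v k)" using C0 \<rho> by simp
        then show ?thesis using False by (auto simp: next_b_def mult.assoc)
      qed
      with next_bound[OF b(1)] show ?case by blast
    qed
  qed
  have D_mono: "mono_on {0..} (D i)" if i: "i \<in> {0..N}" for i
  proof (rule mono_onI)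
    fix s t :: real assume "s \<in> {0..}" "t \<in> {0..}" and st: "s \<le> t"
    then have s: "0 \<le> s" and t: "0 \<le> t" by auto
    let ?C = "\<Sum>k\<in>{1..<N}. L k t / v k"
    \<comment> \<open>A bound gives \<open>D i s - D i t \<le> b i t - b i s\<close>, and
      \<open>b i s\<close> is nonnegative. The bound may change with \<open>n\<close>; only its
      value at \<open>t\<close> matters in the limit.\<close>
    have "D i s - D i t \<le> \<rho> ^ n * ?C * v i" for n
    proof -
      obtain b where b: "bound b" "b i t \<le> \<rho> ^ n * ?C * v i"
        using small[OF t refl, of n] i by auto
      have "b i 0 \<le> b i s" "D i s + b i s \<le> D i t + b i t" "b i 0 = 0"
        using b(1) i s st mono_onD[of "{0..}" "b i" 0 s] mono_onD[of "{0..}" "\<lambda>t. D i t + b i t" s t]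
        by (auto simp: bound_def)
      with b(2) show ?thesis by linarith
    qed
    moreover have "(\<lambda>n. \<rho> ^ n * ?C * v i) \<longlonglongrightarrow> 0 * ?C * v i"
      using \<rho> by (intro tendsto_intros LIMSEQ_realpow_zero) auto
    ultimately have "D i s - D i t \<le> 0"
      by (intro LIMSEQ_le_const[where a = "D i s - D i t"]) auto
    then show "D i s \<le> D i t" by simp
  qed
  have "bound (\<lambda>_ _. 0)" using D_mono by (auto simp: bound_def intro: mono_onI)
  \<comment> \<open>One step from the zero bound leaves exactly minus the negative part of
    \<open>E k\<close>. This function is never positive, starts at 0 and is nondecreasing, hence it
    vanishes.\<close>
  from next_bound[OF this] have "mono_on {0..} (\<lambda>t. - max 0 (- E k t))"
    using k by (auto simp: bound_def next_b_def Q_def dest!: bspec[of _ _ k])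
  then have "0 \<le> E k t" if "0 \<le> t" for t
    using mono_onD[of "{0..}" "\<lambda>t. - max 0 (- E k t)" 0 t] that E0[OF k] by auto
  with D_mono k show ?thesis by auto
qed

section \<open>Comparison of two reflected systems of paths\<close>

text \<open>Both systems share the driving paths \<open>X\<close>, which cancel in the difference of
  gaps; what remains is linear in the differences of local times.\<close>

lemma reflected_paths_comparison:
  fixes X Y Y' L L' :: "nat \<Rightarrow> real \<Rightarrow> real"
  assumes N: "1 < N" and q: "collision_parameters N qp qm"
    and Y: "\<And>k t. k \<in> {1..N} \<Longrightarrow> 0 \<le> t \<Longrightarrow> Y k t = X k t + qp k * L (k - 1) t - qm k * L k t"
    and Y': "\<And>k t. k \<in> {1..N} \<Longrightarrow> 0 \<le> t \<Longrightarrow> Y' k t = X k t + qp k * L' (k - 1) t - qm k * L' k t"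
    and ord: "\<And>k t. k \<in> {1..<N} \<Longrightarrow> 0 \<le> t \<Longrightarrow> Y k t \<le> Y (k + 1) t"
    and ord': "\<And>k t. k \<in> {1..<N} \<Longrightarrow> 0 \<le> t \<Longrightarrow> Y' k t \<le> Y' (k + 1) t"
    and cont: "\<And>k. k \<in> {1..N} \<Longrightarrow> continuous_on {0..} (Y k)"
    and cont': "\<And>k. k \<in> {1..N} \<Longrightarrow> continuous_on {0..} (Y' k)"
    and Lcont: "\<And>k. k \<in> {1..<N} \<Longrightarrow> continuous_on {0..} (L k)"
    and Lcont': "\<And>k. k \<in> {1..<N} \<Longrightarrow> continuous_on {0..} (L' k)"
    and Lmono: "\<And>k. k \<in> {0..N} \<Longrightarrow> mono_on {0..} (L k)"
    and Lmono': "\<And>k. k \<in> {1..<N} \<Longrightarrow> mono_on {0..} (L' k)"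
    and L0: "\<And>k. k \<in> {0..N} \<Longrightarrow> L k 0 = 0"
    and L0': "\<And>k. k \<in> {0..N} \<Longrightarrow> L' k 0 = 0"
    and boundary: "\<And>t. 0 \<le> t \<Longrightarrow> L 0 t = 0" "\<And>t. 0 \<le> t \<Longrightarrow> L' 0 t = 0" "\<And>t. 0 \<le> t \<Longrightarrow> L' N t = 0"
    and inc: "\<And>k. k \<in> {1..<N} \<Longrightarrow> increases_only_on (L k) {t. Y k t = Y (k + 1) t}"
    and inc': "\<And>k. k \<in> {1..<N} \<Longrightarrow> increases_only_on (L' k) {t. Y' k t = Y' (k + 1) t}"
  shows "(\<forall>k\<in>{1..N}. \<forall>t\<ge>0. Y k t \<le> Y' k t) \<and>
    (\<forall>k\<in>{1..<N}. \<forall>t\<ge>0. Y (k + 1) t - Y k t \<le> Y' (k + 1) t - Y' k t) \<and>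
    (\<forall>k\<in>{1..<N}. \<forall>s t. 0 \<le> s \<and> s \<le> t \<longrightarrow> L' k t - L' k s \<le> L k t - L k s)"
proof -
  define D where "D k t = L k t - L' k t" for k t
  define E where "E k t = (Y' (k + 1) t - Y' k t) - (Y (k + 1) t - Y k t)" for k t
  have main: "mono_on {0..} (D k) \<and> (\<forall>t\<ge>0. 0 \<le> E k t)" if k: "k \<in> {1..<N}" for k
  proof (rule comparison_system[OF q])
    have Lm: "L i s \<le> L i t" if "i \<in> {0..N}" "0 \<le> s" "s \<le> t" for i s t
      using mono_onD[OF Lmono, of i s t] that by auto
    have Lm': "L' i s \<le> L' i t" if "i \<in> {1..<N}" "0 \<le> s" "s \<le> t" for i s t
      using mono_onD[OF Lmono', of i s t] that by auto
    show "E i t = - D i t + qm (i + 1) * D (i + 1) t + qp i * D (i - 1) t"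
      if i: "i \<in> {1..<N}" and t: "0 \<le> t" for i t
    proof -
      \<comment> \<open>With this relation the coefficient of \<open>D i\<close> is
        \<open>- (qp (i + 1) + qm i) = - 1\<close>.\<close>
      have q1: "qp (i + 1) = 1 - qm i"
        using q i by (auto simp: collision_parameters_def algebra_simps)
      have "i \<in> {1..N}" "i + 1 \<in> {1..N}" using i by auto
      then show ?thesis using t
        by (simp add: E_def D_def Y Y' q1[simplified] algebra_simps)
    qed
    show "continuous_on {0..} (E i)" if "i \<in> {1..<N}" for i
      unfolding E_def using that by (intro continuous_intros cont cont') auto
    show "D i t \<le> D i u" if i: "i \<in> {1..<N}" and u: "0 \<le> u" "u \<le> t"
      and neg: "\<And>v. u < v \<Longrightarrow> v \<le> t \<Longrightarrow> E i v < 0" for i u t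
    proof -
      have "L i t = L i u"
      proof (rule increases_only_on_constant[OF inc[OF i] Lcont[OF i] Lmono u])
        \<comment> \<open>A negative \<open>E i v\<close> makes the gap of \<open>Y\<close> strictly
          larger than that of \<open>Y'\<close>, which is nonnegative; so \<open>Y\<close> has no
          collision here.\<close>
        have "Y i v \<noteq> Y (i + 1) v" if "v \<in> {u<..t}" for v
          using neg[of v] ord'[OF i, of v] u that by (auto simp: E_def)
        then show "{u<..t} \<inter> {t. Y i t = Y (i + 1) t} = {}" by blast
      qed (use i in auto)
      with Lm'[OF i u] show ?thesis by (simp add: D_def)
    qed
    show "D i u \<le> D i t" if i: "i \<in> {1..<N}" and u: "0 \<le> u" "u \<le> t"
      and neg: "\<And>v. u < v \<Longrightarrow> v \<le> t \<Longrightarrow> 0 < E i v" for i u t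
    proof -
      have "L' i t = L' i u"
      proof (rule increases_only_on_constant[OF inc'[OF i] Lcont'[OF i] Lmono'[OF i] u])
        have "Y' i v \<noteq> Y' (i + 1) v" if "v \<in> {u<..t}" for v
          using neg[of v] ord[OF i, of v] u that by (auto simp: E_def)
        then show "{u<..t} \<inter> {t. Y' i t = Y' (i + 1) t} = {}" by blast
      qed
      with Lm[OF _ u, of i] i show ?thesis by (simp add: D_def)
    qed
    show "D i 0 = 0" if "i \<in> {0..N}" for i
      using that L0 L0' by (auto simp: D_def)
    show "mono_on {0..} (D 0)"
      by (auto intro!: mono_onI simp: D_def boundary)
    \<comment> \<open>Since \<open>L' N\<close> vanishes, \<open>D N\<close> agrees with
      \<open>L N\<close>.\<close>
    show "mono_on {0..} (D N)"
      by (auto intro!: mono_onI Lm simp: D_def boundary)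
    show "mono_on {0..} (L' i)" if "i \<in> {1..<N}" for i
      using Lmono'[OF that] .
    show "L' i 0 = 0" if "i \<in> {1..<N}" for i using L0' that by auto
    show "mono_on {0..} (\<lambda>t. D i t + L' i t)"
      if "i \<in> {1..<N}" for i using Lmono that by (auto simp: D_def)
  qed (fact k)
  have gap: "Y (k + 1) t - Y k t \<le> Y' (k + 1) t - Y' k t" if "k \<in> {1..<N}" "0 \<le> t" for k t
    using main[OF that(1)] that(2) by (simp add: E_def)
  have Linc: "L' k t - L' k s \<le> L k t - L k s" if "k \<in> {1..<N}" "0 \<le> s" "s \<le> t" for k s t
    using mono_onD[OF main[OF that(1), THEN conjunct1], of s t] that by (simp add: D_def)
  have "Y k t \<le> Y' k t" if k: "k \<in> {1..N}" and t: "0 \<le> t" for k t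
  proof -
    \<comment> \<open>The lowest particle is compared through its only local time
      \<open>L 1\<close>; adding the gap inequalities then climbs to the other particles.\<close>
    from k have "1 \<le> k" by simp
    then show ?thesis using k
    proof (induction k rule: dec_induct)
      case base
      have "L' 1 t \<le> L 1 t" using Linc[of 1 0 t] N t L0[of 1] L0'[of 1] by auto
      moreover have "0 < qm 1" using q N by (auto simp: collision_parameters_def)
      ultimately have "qm 1 * L' 1 t \<le> qm 1 * L 1 t" by simp
      then show ?case using Y[of 1 t] Y'[of 1 t] N t boundary by auto
    next
      case (step n)
      then show ?case using gap[of n t] t by auto
    qed
  qed
  with gap Linc show ?thesis by auto
qed

section \<open>Transfer to competing Brownian particles\<close>

theorem corollary3p9:
  fixes P :: "'a measure" and F :: "real \<Rightarrow> 'a measure"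
    and N M :: nat
    and g \<sigma> qp qm y :: "nat \<Rightarrow> real"
    and B Y L Y' L' :: "nat \<Rightarrow> real \<Rightarrow> 'a \<Rightarrow> real"
  assumes "usual_filtered_prob_space P F"
    and "1 < N" and "N \<le> M"
    and "y \<in> ordered_vectors M"
    and "competing_brownian_particles P F M g \<sigma> qp qm B Y L"
    and "starts_from P M Y y"
    and "competing_brownian_particles P F N g \<sigma> qp qm B Y' L'"
    and "starts_from P N Y' y"
  shows "AE \<omega> in P.
      (\<forall>k\<in>{1..N}. \<forall>t\<ge>0. Y k t \<omega> \<le> Y' k t \<omega>) \<and>
      (\<forall>k\<in>{1..N-1}. \<forall>t\<ge>0. gap_process Y k t \<omega> \<le> gap_process Y' k t \<omega>) \<and>
      (\<forall>k\<in>{1..N-1}. \<forall>s t. 0 \<le> s \<and> s \<le> t \<longrightarrow>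
         L k t \<omega> - L k s \<omega> \<ge> L' k t \<omega> - L' k s \<omega>)"
proof -
  note cbp = assms(5)[unfolded competing_brownian_particles_def]
  note cbp' = assms(7)[unfolded competing_brownian_particles_def]
  have q: "collision_parameters N qp qm" using cbp' by blast
  have cY: "AE \<omega> in P. \<forall>k\<in>{1..M}. continuous_on {0..} (\<lambda>t. Y k t \<omega>)"
    using cbp by (intro AE_finite_allI) (auto simp: continuous_process_def)
  have cY': "AE \<omega> in P. \<forall>k\<in>{1..N}. continuous_on {0..} (\<lambda>t. Y' k t \<omega>)"
    using cbp' by (intro AE_finite_allI) (auto simp: continuous_process_def)
  have cL: "AE \<omega> in P. \<forall>k\<in>{1..<M}. continuous_on {0..} (\<lambda>t. L k t \<omega>)"
    using cbp by (intro AE_finite_allI) (auto simp: continuous_process_def)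
  have cL': "AE \<omega> in P. \<forall>k\<in>{1..<N}. continuous_on {0..} (\<lambda>t. L' k t \<omega>)"
    using cbp' by (intro AE_finite_allI) (auto simp: continuous_process_def)
  note eqs = cbp[THEN conjunct2, THEN conjunct2, THEN conjunct2, THEN conjunct2, THEN conjunct2]
  note eqs' = cbp'[THEN conjunct2, THEN conjunct2, THEN conjunct2, THEN conjunct2, THEN conjunct2]
  show ?thesis
    using cY cY' cL cL' eqs eqs' assms(6,8)[unfolded starts_from_def]
  proof eventually_elim
    case (elim \<omega>)
    \<comment> \<open>The common start \<open>y\<close> and the common Brownian motions give both
      systems the same driving path.\<close>
    define X where "X k t = y k + g k * t + \<sigma> k * B k t \<omega>" for k t
    have L_ends: "L 0 t \<omega> = 0" "L M t \<omega> = 0" if "0 \<le> t" for t using elim(5) that by blast+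
    have L'_ends: "L' 0 t \<omega> = 0" "L' N t \<omega> = 0" if "0 \<le> t" for t using elim(6) that by blast+
    have L_inner: "L k 0 \<omega> = 0" "mono_on {0..} (\<lambda>t. L k t \<omega>)"
      "increases_only_on (\<lambda>t. L k t \<omega>) {t. Y k t \<omega> = Y (k + 1) t \<omega>}" if "k \<in> {1..<M}" for k
      using elim(5) that by blast+
    have L'_inner: "L' k 0 \<omega> = 0" "mono_on {0..} (\<lambda>t. L' k t \<omega>)"
      "increases_only_on (\<lambda>t. L' k t \<omega>) {t. Y' k t \<omega> = Y' (k + 1) t \<omega>}" if "k \<in> {1..<N}" for k
      using elim(6) that by blast+
    \<comment> \<open>The index \<open>N\<close> is included: \<open>L N\<close> is a genuine local
      time if \<open>N < M\<close> and the conventional zero process if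
      \<open>N = M\<close>.\<close>
    have L_mono: "mono_on {0..} (\<lambda>t. L k t \<omega>)" and L_init: "L k 0 \<omega> = 0" if "k \<in> {0..N}" for k
    proof -
      from that \<open>N \<le> M\<close> consider "k \<in> {1..<M}" | "k = 0" | "k = M" by fastforce
      then have "mono_on {0..} (\<lambda>t. L k t \<omega>) \<and> L k 0 \<omega> = 0"
        by cases (auto simp: L_inner L_ends intro: mono_onI)
      then show "mono_on {0..} (\<lambda>t. L k t \<omega>)" "L k 0 \<omega> = 0" by auto
    qed
    have L'_init: "L' k 0 \<omega> = 0" if "k \<in> {0..N}" for k
    proof -
      from that consider "k \<in> {1..<N}" | "k = 0" | "k = N" by fastforce
      then show ?thesis by cases (simp_all add: L'_inner L'_ends)
    qed
    have ord: "Y k t \<omega> \<le> Y (k + 1) t \<omega>" if "k \<in> {1..<N}" "0 \<le> t" for k t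
    proof -
      have "mono_on {1..M} (\<lambda>k. Y k t \<omega>)"
        using elim(5) that(2) unfolding ordered_vectors_def by blast
      then show ?thesis using that(1) \<open>N \<le> M\<close> by (auto elim!: mono_onD)
    qed
    have ord': "Y' k t \<omega> \<le> Y' (k + 1) t \<omega>" if "k \<in> {1..<N}" "0 \<le> t" for k t
    proof -
      have "mono_on {1..N} (\<lambda>k. Y' k t \<omega>)"
        using elim(6) that(2) unfolding ordered_vectors_def by blast
      then show ?thesis using that(1) by (auto elim!: mono_onD)
    qed
    have Y_eq: "Y k t \<omega> = X k t + qp k * L (k - 1) t \<omega> - qm k * L k t \<omega>"
      if "k \<in> {1..N}" "0 \<le> t" for k t
    proof -
      have "k \<in> {1..M}" using that \<open>N \<le> M\<close> by auto
      then have "Y k 0 \<omega> = y k" "Y k t \<omega> = Y k 0 \<omega> + g k * t + \<sigma> k * B k t \<omega>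
          + qp k * L (k - 1) t \<omega> - qm k * L k t \<omega>"
        using elim(5,7) that(2) by blast+
      then show ?thesis unfolding X_def by linarith
    qed
    have Y'_eq: "Y' k t \<omega> = X k t + qp k * L' (k - 1) t \<omega> - qm k * L' k t \<omega>"
      if "k \<in> {1..N}" "0 \<le> t" for k t
    proof -
      have "Y' k 0 \<omega> = y k" "Y' k t \<omega> = Y' k 0 \<omega> + g k * t + \<sigma> k * B k t \<omega>
          + qp k * L' (k - 1) t \<omega> - qm k * L' k t \<omega>"
        using elim(6,8) that by blast+
      then show ?thesis unfolding X_def by linarith
    qed
    have "(\<forall>k\<in>{1..N}. \<forall>t\<ge>0. Y k t \<omega> \<le> Y' k t \<omega>) \<and>
      (\<forall>k\<in>{1..<N}. \<forall>t\<ge>0. Y (k + 1) t \<omega> - Y k t \<omega> \<le> Y' (k + 1) t \<omega> - Y' k t \<omega>) \<and>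
      (\<forall>k\<in>{1..<N}. \<forall>s t. 0 \<le> s \<and> s \<le> t \<longrightarrow> L' k t \<omega> - L' k s \<omega> \<le> L k t \<omega> - L k s \<omega>)"
      by (rule reflected_paths_comparison[OF \<open>1 < N\<close> q Y_eq Y'_eq ord ord'])
        (use elim(1-4) L_mono L_init L_ends L_inner L'_init L'_ends L'_inner \<open>N \<le> M\<close> in auto)
    moreover have "{1..N-1} = {1..<N}" using \<open>1 < N\<close> by auto
    ultimately show ?case unfolding gap_process_def by auto
  qed
qed

end
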